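(* Let $X=(X_1,\dots,X_m)$ be a discrete random vector with $X_i$ having $r_i\ge 1$ possible outcomes. Let $\Delta$ be an abstract simplicial complex on $[m]=\{1,\dots,m\}$ and let $\mathcal{M}_{\Delta}$ be the hierarchical log-linear model for $X$ on $\Delta$. Then the rank of the matrix $A_\Delta$ of sufficient statistics of this model is $$E(\Delta;\log(r_1),\dots,\log(r_m)).$$
   Context: Simplicial complexes are finite and the empty face is counted as a face. Exponential Hilbert series: let $k$ be a field and $S=k[x_1,\dots,x_m]$. The Stanley-Reisner ideal $I_\Delta\subseteq S$ is generated by the monomials $\prod_{i\in\tau}x_i$ with $\tau\subseteq[m]$, $\tau\notin\Delta$, and $S/I_\Delta$ is $\mathbb{N}^m$-graded. We write $$E(\Delta;x_1,\dots,x_m):=E(S/I_\Delta;x_1,\dots,x_m)=\sum_{\mathbf{a}\in\mathbb{N}^m}\dim_k\big((S/I_\Delta)_{\mathbf{a}}\big)\frac{\mathbf{x}^{\mathbf{a}}}{\mathbf{a}!},$$ with $\mathbf{x}^{\mathbf a}=x_1^{a_1}\cdots x_m^{a_m}$, $\mathbf{a}!=a_1!\cdots a_m!$. This series converges for all real arguments and is evaluated at $x_i=\log(r_i)$ (natural logarithm). Hierarchical model: let $[r_i]=\{1,\dots,r_i\}$ be the state space of $X_i$, $\mathcal{R}=\prod_{i=1}^m[r_i]$, and for $\sigma\subseteq[m]$ let $\mathcal{R}_\sigma=\prod_{f\in\sigma}[r_f]$; for $i=(i_1,\dots,i_m)\in\mathcal{R}$ let $i_\sigma=(i_f)_{f\in\sigma}\in\mathcal{R}_\sigma$.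 For each facet (maximal face) $\sigma$ of $\Delta$ take positive parameters $\theta^{(\sigma)}_{j}$, $j\in\mathcal{R}_\sigma$. The hierarchical log-linear model $\mathcal{M}_\Delta$ is the set of probability distributions $p$ on $\mathcal{R}$ of the form $p_i=\frac{1}{Z(\theta)}\prod_{\sigma\text{ facet of }\Delta}\theta^{(\sigma)}_{i_\sigma}$ for all $i\in\mathcal{R}$, where $Z(\theta)=\sum_{i\in\mathcal{R}}\prod_{\sigma}\theta^{(\sigma)}_{i_\sigma}$. The matrix $A_\Delta$ is the $\{0,1\}$-matrix describing this parametrization: its columns are indexed by $i\in\mathcal{R}$, its rows by pairs $(\sigma,j)$ with $\sigma$ a facet of $\Delta$ and $j\in\mathcal{R}_\sigma$, and its entry in row $(\sigma,j)$ and column $i$ is $1$ if $i_\sigma=j$ and $0$ otherwise. Rank is over $\mathbb{Q}$. *)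

theory Defs
  imports
    "HOL-Library.Poly_Mapping"
    "HOL-Algebra.QuotRing"
    "HOL-Algebra.Embedded_Algebras"
    "HOL-Probability.Probability_Mass_Function"
    "Jordan_Normal_Form.DL_Rank"
begin

section \<open>Simplicial complexes on [m]\<close>

text \<open>Not every singleton is required to be a face.\<close>

definition abstract_simplicial_complex :: "nat \<Rightarrow> nat set set \<Rightarrow> bool" where
  "abstract_simplicial_complex m \<Delta> \<longleftrightarrow>
     \<Delta> \<subseteq> Pow {1..m} \<and> {} \<in> \<Delta> \<and> (\<forall>\<sigma>\<in>\<Delta>. \<forall>\<tau>. \<tau> \<subseteq> \<sigma> \<longrightarrow> \<tau> \<in> \<Delta>)"

definition facets :: "nat set set \<Rightarrow> nat set set" where
  "facets \<Delta> = {\<sigma> \<in> \<Delta>. \<forall>\<tau>\<in>\<Delta>. \<sigma> \<subseteq> \<tau> \<longrightarrow> \<sigma> = \<tau>}"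


section \<open>The exponential Hilbert series of a Stanley-Reisner ring\<close>

text \<open>
  An exponent vector is a finitely supported function from \<^typ>\<open>nat\<close> to \<^typ>\<open>nat\<close>, and a
  polynomial is a finitely supported function from exponent vectors to coefficients;
  the product of the type is the convolution product.
\<close>

type_synonym expo = "nat \<Rightarrow>\<^sub>0 nat"
type_synonym 'k mpoly = "expo \<Rightarrow>\<^sub>0 'k"

definition expos :: "nat \<Rightarrow> expo set" where
  "expos m = {a. Poly_Mapping.keys a \<subseteq> {1..m}}"

definition polynomial_ring :: "nat \<Rightarrow> ('k::field) mpoly ring" where
  "polynomial_ring m =
     \<lparr>carrier = {p. Poly_Mapping.keys p \<subseteq> expos m}, monoid.mult = (*), one = 1, zero = 0, add = (+)\<rparr>"

lemma cring_polynomial_ring: "cring (polynomial_ring m :: ('k::field) mpoly ring)"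
proof (rule cringI)
  have add: "p + q \<in> carrier (polynomial_ring m)"
    if "p \<in> carrier (polynomial_ring m)" "q \<in> carrier (polynomial_ring m)" for p q :: "'k mpoly"
    using that Poly_Mapping.keys_add[of p q] by (auto simp: polynomial_ring_def)
  have neg: "- p \<in> carrier (polynomial_ring m)"
    if "p \<in> carrier (polynomial_ring m)" for p :: "'k mpoly"
    using that by (auto simp: polynomial_ring_def expos_def in_keys_iff subset_iff)
  have mul: "p * q \<in> carrier (polynomial_ring m)"
    if "p \<in> carrier (polynomial_ring m)" "q \<in> carrier (polynomial_ring m)" for p q :: "'k mpoly"
  proof -
    have "a + b \<in> expos m" if "a \<in> expos m" "b \<in> expos m" for a b
      using that Poly_Mapping.keys_add[of a b] by (auto simp: expos_def)
    then show ?thesis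
      using that keys_mult[of p q] by (fastforce simp: polynomial_ring_def)
  qed
  show "abelian_group (polynomial_ring m :: 'k mpoly ring)"
  proof (rule abelian_groupI)
    fix p :: "'k mpoly" assume "p \<in> carrier (polynomial_ring m)"
    then show "\<exists>q\<in>carrier (polynomial_ring m). q \<oplus>\<^bsub>polynomial_ring m\<^esub> p = \<zero>\<^bsub>polynomial_ring m\<^esub>"
      by (intro bexI[of _ "- p"] neg) (auto simp: polynomial_ring_def)
  qed (use add in \<open>auto simp: polynomial_ring_def add_ac\<close>)
  show "comm_monoid (polynomial_ring m :: 'k mpoly ring)"
    by (rule comm_monoidI) (use mul in \<open>auto simp: polynomial_ring_def expos_def mult_ac\<close>)
qed (auto simp: polynomial_ring_def algebra_simps)

definition var :: "nat \<Rightarrow> ('k::field) mpoly" where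
  "var i = Poly_Mapping.single (Poly_Mapping.single i 1) 1"

definition stanley_reisner_ideal :: "nat \<Rightarrow> nat set set \<Rightarrow> ('k::field) mpoly set" where
  "stanley_reisner_ideal m \<Delta> =
     Idl\<^bsub>polynomial_ring m\<^esub> {\<Prod>i\<in>\<tau>. var i |\<tau>. \<tau> \<subseteq> {1..m} \<and> \<tau> \<notin> \<Delta>}"

abbreviation quotient_map :: "nat \<Rightarrow> ('k::field) mpoly set \<Rightarrow> 'k mpoly \<Rightarrow> 'k mpoly set" where
  "quotient_map m I f \<equiv> I +>\<^bsub>polynomial_ring m\<^esub> f"

definition graded_piece :: "nat \<Rightarrow> ('k::field) mpoly set \<Rightarrow> expo \<Rightarrow> 'k mpoly set set" where
  "graded_piece m I a = quotient_map m I ` range (Poly_Mapping.single a)"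

text \<open>
  For proper \<open>I\<close> the scalars \<open>k\<close> embed into \<open>S/I\<close> as the classes of the constant polynomials,
  and \<open>ring.dim\<close> is the dimension over this subfield.
\<close>

definition hilbert_function :: "nat \<Rightarrow> ('k::field) mpoly set \<Rightarrow> expo \<Rightarrow> nat" where
  "hilbert_function m I a =
     ring.dim (polynomial_ring m Quot I) (graded_piece m I 0) (graded_piece m I a)"

text \<open>
  A divergent \<open>infsum\<close> is \<open>0\<close>. An equation between the series and a nonzero number therefore
  includes convergence.
\<close>

definition exp_hilbert_series :: "nat \<Rightarrow> ('k::field) mpoly set \<Rightarrow> (nat \<Rightarrow> real) \<Rightarrow> real" where
  "exp_hilbert_series m I x =
     (\<Sum>\<^sub>\<infinity>a\<in>expos m. real (hilbert_function m I a) *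
        ((\<Prod>i=1..m. x i ^ Poly_Mapping.lookup a i) / (\<Prod>i=1..m. fact (Poly_Mapping.lookup a i))))"


section \<open>Hierarchical log-linear models\<close>

definition states :: "(nat \<Rightarrow> nat) \<Rightarrow> nat set \<Rightarrow> (nat \<Rightarrow> nat) set" where
  "states r \<sigma> = (\<Pi>\<^sub>E f\<in>\<sigma>. {1..r f})"

definition hierarchical_model ::
    "nat \<Rightarrow> (nat \<Rightarrow> nat) \<Rightarrow> nat set set \<Rightarrow> (nat \<Rightarrow> nat) pmf set" where
  "hierarchical_model m r \<Delta> =
     {p. set_pmf p \<subseteq> states r {1..m} \<and>
        (\<exists>\<theta> :: nat set \<Rightarrow> (nat \<Rightarrow> nat) \<Rightarrow> real.
           (\<forall>\<sigma>\<in>facets \<Delta>. \<forall>j\<in>states r \<sigma>. 0 < \<theta> \<sigma> j) \<and>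
           (\<forall>i\<in>states r {1..m}.
              pmf p i = 1 / (\<Sum>i'\<in>states r {1..m}. \<Prod>\<sigma>\<in>facets \<Delta>. \<theta> \<sigma> (restrict i' \<sigma>)) *
                (\<Prod>\<sigma>\<in>facets \<Delta>. \<theta> \<sigma> (restrict i \<sigma>))))}"

definition parameter_indices ::
    "(nat \<Rightarrow> nat) \<Rightarrow> nat set set \<Rightarrow> (nat set \<times> (nat \<Rightarrow> nat)) set" where
  "parameter_indices r \<Delta> = (SIGMA \<sigma> : facets \<Delta>. states r \<sigma>)"

definition suff_stat :: "nat set \<times> (nat \<Rightarrow> nat) \<Rightarrow> (nat \<Rightarrow> nat) \<Rightarrow> 'a::zero_neq_one" where
  "suff_stat = (\<lambda>(\<sigma>, j) i. if restrict i \<sigma> = j then 1 else 0)"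

text \<open>
  Matrices are indexed by initial segments of the natural numbers, so the matrix \<open>A\<^sub>\<Delta>\<close> is written
  down with respect to enumerations \<open>rs\<close> of the parameter indices and \<open>cs\<close> of the states.
\<close>

definition suff_stat_matrix ::
    "(nat set \<times> (nat \<Rightarrow> nat)) list \<Rightarrow> (nat \<Rightarrow> nat) list \<Rightarrow> rat mat" where
  "suff_stat_matrix rs cs =
     mat (length rs) (length cs) (\<lambda>(a, b). suff_stat (rs ! a) (cs ! b))"

text \<open>The columns of \<open>A\<^sub>\<Delta>\<close> are the exponent vectors of the parametrization of the model.\<close>

lemma suff_stat_parametrization:
  fixes \<theta> :: "nat set \<Rightarrow> (nat \<Rightarrow> nat) \<Rightarrow> real"
  assumes "abstract_simplicial_complex m \<Delta>" and "i \<in> states r {1..m}"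
  shows "(\<Prod>\<sigma>\<in>facets \<Delta>. \<theta> \<sigma> (restrict i \<sigma>)) =
    (\<Prod>(\<sigma>, j)\<in>parameter_indices r \<Delta>. \<theta> \<sigma> j ^ suff_stat (\<sigma>, j) i)"
proof -
  have sub: "\<sigma> \<subseteq> {1..m}" if "\<sigma> \<in> facets \<Delta>" for \<sigma>
    using assms(1) that by (auto simp: abstract_simplicial_complex_def facets_def)
  have fin: "finite (facets \<Delta>)"
    by (rule finite_subset[of _ "Pow {1..m}"]) (use sub in auto)
  have finst: "finite (states r \<sigma>)" if "\<sigma> \<in> facets \<Delta>" for \<sigma>
    using finite_subset[OF sub[OF that]] by (auto simp: states_def intro!: finite_PiE)
  have mem: "restrict i \<sigma> \<in> states r \<sigma>" if "\<sigma> \<in> facets \<Delta>" for \<sigma>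
    using assms(2) sub[OF that] by (auto simp: states_def PiE_iff)
  have "(\<Prod>(\<sigma>, j)\<in>parameter_indices r \<Delta>. \<theta> \<sigma> j ^ suff_stat (\<sigma>, j) i) =
      (\<Prod>\<sigma>\<in>facets \<Delta>. \<Prod>j\<in>states r \<sigma>. \<theta> \<sigma> j ^ suff_stat (\<sigma>, j) i)"
    unfolding parameter_indices_def using fin finst by (subst prod.Sigma) auto
  also have "\<dots> = (\<Prod>\<sigma>\<in>facets \<Delta>. \<theta> \<sigma> (restrict i \<sigma>))"
  proof (rule prod.cong[OF refl])
    fix \<sigma> assume s: "\<sigma> \<in> facets \<Delta>"
    have "(\<Prod>j\<in>states r \<sigma>. \<theta> \<sigma> j ^ suff_stat (\<sigma>, j) i) =
        (\<Prod>j\<in>states r \<sigma>. if restrict i \<sigma> = j then \<theta> \<sigma> j else 1)"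
      by (intro prod.cong) (auto simp: suff_stat_def)
    then show "(\<Prod>j\<in>states r \<sigma>. \<theta> \<sigma> j ^ suff_stat (\<sigma>, j) i) = \<theta> \<sigma> (restrict i \<sigma>)"
      using finst[OF s] mem[OF s] by (simp add: prod.delta')
  qed
  finally show ?thesis by simp
qed

end

theory Submission
  imports Defs "HOL-Analysis.Infinite_Set_Sum"
begin

text \<open>
  Both sides count the states whose support is a face, where the support of a state
  \<open>i\<close> is the set of variables \<open>f\<close> with \<open>i f \<noteq> 1\<close>. A state with support \<open>F\<close> is a choice of one of
  the \<open>r f - 1\<close> values other than \<open>1\<close> for each \<open>f \<in> F\<close>, so there are
  \<open>\<Sum>F\<in>\<Delta>. \<Prod>f\<in>F. (r f - 1)\<close> such states.

  On the statistical side, the columns of these states form a basis of the column space. They are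
  independent (\<open>basis_columns_independent\<close>) because a linear relation among them is
  inherited by all marginals over faces. The marginal over the support of \<open>i\<close>, at the values of
  \<open>i\<close>, only involves \<open>i\<close> and states of strictly larger support, so that the relation is triangular.
  They span (\<open>basis_columns_span\<close>) because for a state \<open>i\<close> whose support \<open>T\<close> is not a face, the
  columns of the states obtained from \<open>i\<close> by resetting the variables outside \<open>U \<subseteq> T\<close> to \<open>1\<close>
  have alternating sum \<open>0\<close>: a facet \<open>\<sigma>\<close> misses some \<open>t \<in> T\<close>, and the \<open>\<sigma>\<close>-marginal does
  not see whether \<open>t \<in> U\<close>. This expresses the column of \<open>i\<close> by columns of smaller support.

  On the algebraic side, the degree \<open>a\<close> part of \<open>S/I\<^sub>\<Delta>\<close> is spanned by the class of the monomial
  \<open>x\<^sup>a\<close>, which vanishes exactly if the support of \<open>a\<close> is not a face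
  (\<open>hilbert_function_stanley_reisner\<close>). Grouping exponents by support, the exponents with support
  \<open>F\<close> contribute \<open>\<Prod>f\<in>F. (\<Sum>n\<ge>1. x\<^sub>f\<^sup>n / n!) = \<Prod>f\<in>F. (exp x\<^sub>f - 1)\<close>, which is
  \<open>\<Prod>f\<in>F. (r f - 1)\<close> for \<open>x\<^sub>f = ln (r f)\<close>.
\<close>

section \<open>Rank and bases of the column space\<close>

text \<open>
  The matrix is indexed through functions on labels, and independence is that of the family of
  columns labelled by \<open>B\<close>. In particular these columns are pairwise distinct, so that the set of
  columns has as many elements as \<open>B\<close>.
\<close>

lemma rank_eq_card_of_column_basis:
  fixes f :: "'r \<Rightarrow> 'c \<Rightarrow> 'a::field"
  assumes B: "B \<subseteq> set cs"
    and indep: "\<And>c i. \<lbrakk>\<And>\<rho>. \<rho> \<in> set rs \<Longrightarrow> (\<Sum>j\<in>B. c j * f \<rho> j) = 0; i \<in> B\<rbrakk> \<Longrightarrow> c i = 0"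
    and span: "\<And>i. i \<in> set cs \<Longrightarrow> \<exists>c. \<forall>\<rho>\<in>set rs. f \<rho> i = (\<Sum>j\<in>B. c j * f \<rho> j)"
  shows "vec_space.rank (length rs) (mat (length rs) (length cs) (\<lambda>(a, b). f (rs ! a) (cs ! b))) = card B"
proof -
  define n where "n = length rs"
  define A where "A = mat n (length cs) (\<lambda>(a, b). f (rs ! a) (cs ! b))"
  define v where "v i = vec n (\<lambda>a. f (rs ! a) i)" for i
  interpret vec_space "TYPE('a)" n .
  have A: "A \<in> carrier_mat n (length cs)" by (simp add: A_def)
  have v: "v i \<in> carrier_vec n" for i by (simp add: v_def)
  have finB: "finite B" using B finite_subset by blast
  have cols: "set (cols A) = v ` set cs"
  proof -
    have "set (cols A) = (\<lambda>b. v (cs ! b)) ` {0..<length cs}"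
      unfolding cols_def set_map set_upt
      by (intro image_cong) (auto simp: A_def v_def)
    also have "\<dots> = v ` set cs"
      using nth_image[of "length cs" cs] by (simp add: image_image[symmetric] atLeast0LessThan)
    finally show ?thesis .
  qed
  have inj: "inj_on v B"
  proof (rule inj_onI, rule ccontr)
    fix i j assume ij: "i \<in> B" "j \<in> B" "v i = v j" "i \<noteq> j"
    have eq: "f \<rho> i = f \<rho> j" if "\<rho> \<in> set rs" for \<rho>
    proof -
      obtain a where "a < n" "rs ! a = \<rho>" using \<open>\<rho> \<in> set rs\<close> by (auto simp: in_set_conv_nth n_def)
      then show ?thesis using arg_cong[OF ij(3), of "\<lambda>w. w $ a"] by (simp add: v_def)
    qed
    \<comment> \<open>Two equal columns would give the relation with coefficients \<open>1\<close> and \<open>-1\<close>.\<close>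
    define c :: "'c \<Rightarrow> 'a" where "c k = (if k = i then 1 else 0) - (if k = j then 1 else 0)" for k
    have "(\<Sum>k\<in>B. c k * f \<rho> k) = 0" if "\<rho> \<in> set rs" for \<rho>
    proof -
      have "(\<Sum>k\<in>B. c k * f \<rho> k) = (\<Sum>k\<in>B. (if k = i then f \<rho> k else 0) - (if k = j then f \<rho> k else 0))"
        by (intro sum.cong) (auto simp: c_def)
      also have "\<dots> = f \<rho> i - f \<rho> j" using finB ij by (simp add: sum_subtractf)
      finally show ?thesis using eq[OF that] by simp
    qed
    from indep[OF this ij(1)] ij(4) show False by (simp add: c_def)
  qed
  have lc: "lincomb a (v ` B) $ k = (\<Sum>j\<in>B. a (v j) * f (rs ! k) j)" if "k < n" for a k
  proof -
    have "lincomb a (v ` B) $ k = (\<Sum>x\<in>v ` B. a x * x $ k)"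
      by (rule lincomb_index[OF that]) (use v in auto)
    also have "\<dots> = (\<Sum>j\<in>B. a (v j) * v j $ k)" by (simp add: sum.reindex[OF inj])
    finally show ?thesis using that by (simp add: v_def)
  qed
  have li: "lin_indpt (v ` B)"
  proof (rule finite_lin_indpt2)
    show "finite (v ` B)" "v ` B \<subseteq> carrier_vec n" using finB v by auto
    fix a assume a: "lincomb a (v ` B) = 0\<^sub>v n"
    have "(\<Sum>j\<in>B. a (v j) * f \<rho> j) = 0" if "\<rho> \<in> set rs" for \<rho>
    proof -
      obtain k where k: "k < n" "rs ! k = \<rho>" using \<open>\<rho> \<in> set rs\<close> by (auto simp: in_set_conv_nth n_def)
      show ?thesis using lc[OF k(1), of a] a k by simp
    qed
    from indep[OF this] show "\<forall>w\<in>v ` B. a w = 0" by blast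
  qed
  have sp: "v i \<in> span (v ` B)" if "i \<in> set cs" for i
  proof -
    obtain c where c: "\<forall>\<rho>\<in>set rs. f \<rho> i = (\<Sum>j\<in>B. c j * f \<rho> j)" using span[OF \<open>i \<in> set cs\<close>] by auto
    define a where "a w = c (the_inv_into B v w)" for w
    have "lincomb a (v ` B) = v i"
    proof (rule eq_vecI)
      show "dim_vec (lincomb a (v ` B)) = dim_vec (v i)"
        using lincomb_dim[of "v ` B" a] finB image_subsetI[of B v, OF v]
        by (simp add: v_def[of i])
      fix k assume "k < dim_vec (v i)"
      then have k: "k < n" by (simp add: v_def)
      show "lincomb a (v ` B) $ k = v i $ k"
      proof -
        have "rs ! k \<in> set rs" using k by (simp add: n_def)
        have "lincomb a (v ` B) $ k = (\<Sum>j\<in>B. a (v j) * f (rs ! k) j)" by (rule lc[OF k])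
        also have "\<dots> = (\<Sum>j\<in>B. c j * f (rs ! k) j)"
          by (intro sum.cong refl) (simp add: a_def the_inv_into_f_f[OF inj])
        also have "\<dots> = f (rs ! k) i" using bspec[OF c \<open>rs ! k \<in> set rs\<close>] by (rule sym)
        finally show ?thesis using k by (simp add: v_def)
      qed
    qed
    from this[symmetric] finB show ?thesis unfolding local.span_def by blast
  qed
  have "maximal (v ` B) (\<lambda>T. T \<subseteq> set (cols A) \<and> lin_indpt T)"
    unfolding maximal_def
  proof (intro conjI allI impI)
    show "v ` B \<subseteq> set (cols A)" using cols B by auto
    show "lin_indpt (v ` B)" by fact
    fix T assume T: "v ` B \<subseteq> T \<and> T \<subseteq> set (cols A) \<and> lin_indpt T"
    show "T = v ` B"
    proof (rule ccontr)
      assume "T \<noteq> v ` B"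
      then obtain w where w: "w \<in> T" "w \<notin> v ` B" using T by blast
      then have "w \<in> span (v ` B)" "w \<in> carrier_vec n" using T cols sp v by auto
      then have "lin_dep (v ` B \<union> {w})"
        using lin_dep_iff_in_span[of "v ` B" w] li w v by auto
      moreover have "v ` B \<union> {w} \<subseteq> T" using T w by auto
      ultimately show False using T supset_ld_is_ld by blast
    qed
  qed
  from rank_card_indpt[OF A this] show ?thesis
    by (simp add: card_image[OF inj] A_def n_def)
qed

section \<open>States supported on faces\<close>

text \<open>The value \<open>1\<close> serves as the base level of each variable.\<close>

definition support :: "nat \<Rightarrow> (nat \<Rightarrow> nat) \<Rightarrow> nat set" where
  "support m i = {f \<in> {1..m}. i f \<noteq> 1}"

definition truncation :: "nat \<Rightarrow> nat set \<Rightarrow> (nat \<Rightarrow> nat) \<Rightarrow> nat \<Rightarrow> nat" where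
  "truncation m U i = (\<lambda>f\<in>{1..m}. if f \<in> U then i f else 1)"

definition basis_states :: "nat \<Rightarrow> (nat \<Rightarrow> nat) \<Rightarrow> nat set set \<Rightarrow> (nat \<Rightarrow> nat) set" where
  "basis_states m r \<Delta> = {i \<in> states r {1..m}. support m i \<in> \<Delta>}"

lemma finite_states: "finite \<sigma> \<Longrightarrow> finite (states r \<sigma>)"
  by (auto simp: states_def intro: finite_PiE)

lemma finite_basis_states: "finite (basis_states m r \<Delta>)"
  by (simp add: basis_states_def finite_states)

lemma restrict_in_states: "i \<in> states r A \<Longrightarrow> B \<subseteq> A \<Longrightarrow> restrict i B \<in> states r B"
  by (auto simp: states_def PiE_iff)

lemma face_subset: "abstract_simplicial_complex m \<Delta> \<Longrightarrow> F \<in> \<Delta> \<Longrightarrow> F \<subseteq> {1..m}"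
  by (auto simp: abstract_simplicial_complex_def)

lemma finite_complex: "abstract_simplicial_complex m \<Delta> \<Longrightarrow> finite \<Delta>"
  by (rule finite_subset[of _ "Pow {1..m}"]) (auto simp: abstract_simplicial_complex_def)

lemma face_subset_facet:
  assumes "abstract_simplicial_complex m \<Delta>" "\<tau> \<in> \<Delta>"
  obtains \<sigma> where "\<sigma> \<in> facets \<Delta>" "\<tau> \<subseteq> \<sigma>"
proof -
  from finite_has_maximal2[OF finite_complex[OF assms(1)] assms(2)]
  obtain \<sigma> where "\<sigma> \<in> \<Delta>" "\<tau> \<subseteq> \<sigma>" "\<forall>\<rho>\<in>\<Delta>. \<sigma> \<subseteq> \<rho> \<longrightarrow> \<sigma> = \<rho>" by blast
  then show thesis by (intro that[of \<sigma>]) (simp_all only: facets_def mem_Collect_eq)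
qed

lemma card_states_with_support:
  assumes "F \<subseteq> {1..m}" and "\<And>f. f \<in> {1..m} \<Longrightarrow> r f \<ge> 1"
  shows "card {i \<in> states r {1..m}. support m i = F} = (\<Prod>f\<in>F. r f - 1)"
proof -
  have "{i \<in> states r {1..m}. support m i = F} = (\<Pi>\<^sub>E f\<in>{1..m}. if f \<in> F then {2..r f} else {1})"
  proof (intro Set.set_eqI iffI)
    fix i assume i: "i \<in> {i \<in> states r {1..m}. support m i = F}"
    have "i f \<in> (if f \<in> F then {2..r f} else {1})" if "f \<in> {1..m}" for f
    proof -
      have "1 \<le> i f" "i f \<le> r f" using i that by (auto simp: states_def PiE_iff)
      moreover have "f \<in> F \<longleftrightarrow> i f \<noteq> 1" using i that by (auto simp: support_def)
      ultimately show ?thesis by auto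
    qed
    then show "i \<in> (\<Pi>\<^sub>E f\<in>{1..m}. if f \<in> F then {2..r f} else {1})"
      using i by (auto simp: states_def PiE_iff)
  next
    fix i assume i: "i \<in> (\<Pi>\<^sub>E f\<in>{1..m}. if f \<in> F then {2..r f} else {1})"
    have "1 \<le> i f \<and> i f \<le> r f \<and> (f \<in> F \<longleftrightarrow> i f \<noteq> 1)" if "f \<in> {1..m}" for f
      using PiE_mem[OF i that] assms(2)[OF that] by (auto split: if_splits)
    then show "i \<in> {i \<in> states r {1..m}. support m i = F}"
      using i assms(1) by (auto simp: states_def PiE_iff support_def)
  qed
  then have "card {i \<in> states r {1..m}. support m i = F}
      = (\<Prod>f\<in>{1..m}. card (if f \<in> F then {2..r f} else {1}))"
    by (simp add: card_PiE)
  also have "\<dots> = (\<Prod>f\<in>F. r f - 1)"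
    by (rule prod.mono_neutral_cong_right) (use assms(1) in auto)
  finally show ?thesis .
qed

lemma card_basis_states:
  assumes "abstract_simplicial_complex m \<Delta>" and "\<And>f. f \<in> {1..m} \<Longrightarrow> r f \<ge> 1"
  shows "card (basis_states m r \<Delta>) = (\<Sum>F\<in>\<Delta>. \<Prod>f\<in>F. r f - 1)"
proof -
  have "basis_states m r \<Delta> = (\<Union>F\<in>\<Delta>. {i \<in> states r {1..m}. support m i = F})"
    by (auto simp: basis_states_def)
  also have "card \<dots> = (\<Sum>F\<in>\<Delta>. card {i \<in> states r {1..m}. support m i = F})"
    by (rule card_UN_disjoint) (use assms in \<open>auto simp: finite_complex finite_states\<close>)
  also have "\<dots> = (\<Sum>F\<in>\<Delta>. \<Prod>f\<in>F. r f - 1)"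
    by (intro sum.cong refl card_states_with_support assms face_subset[OF assms(1)])
  finally show ?thesis .
qed

section \<open>A basis of the column space\<close>

text \<open>
  Summing the equations of the rows \<open>(\<sigma>, j)\<close> over all \<open>j\<close> that agree with \<open>i\<close> on the support
  \<open>\<tau>\<close> of \<open>i\<close> gives the equation of the \<open>\<tau>\<close>-marginal: the coefficients of all states that agree
  with \<open>i\<close> on \<open>\<tau>\<close> add up to \<open>0\<close>. Every such state other than \<open>i\<close> has a support strictly larger
  than \<open>\<tau>\<close>, so its coefficient vanishes by induction on the complement of the support.
\<close>

lemma basis_columns_independent:
  fixes c :: "(nat \<Rightarrow> nat) \<Rightarrow> 'a::field"
  assumes \<Delta>: "abstract_simplicial_complex m \<Delta>"
    and zero: "\<And>\<rho>. \<rho> \<in> parameter_indices r \<Delta> \<Longrightarrow>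
      (\<Sum>k\<in>basis_states m r \<Delta>. c k * suff_stat \<rho> k) = 0"
    and "i \<in> basis_states m r \<Delta>"
  shows "c i = 0"
  using \<open>i \<in> basis_states m r \<Delta>\<close>
proof (induction "card ({1..m} - support m i)" arbitrary: i rule: less_induct)
  case less
  let ?S = "basis_states m r \<Delta>"
  define \<tau> where "\<tau> = support m i"
  have i: "i \<in> states r {1..m}" "\<tau> \<in> \<Delta>" using less.prems by (auto simp: basis_states_def \<tau>_def)
  have \<tau>_sub: "\<tau> \<subseteq> {1..m}" by (auto simp: \<tau>_def support_def)
  obtain \<sigma> where \<sigma>: "\<sigma> \<in> facets \<Delta>" "\<tau> \<subseteq> \<sigma>" using face_subset_facet[OF \<Delta> i(2)] .
  have \<sigma>_sub: "\<sigma> \<subseteq> {1..m}" using face_subset[OF \<Delta>] \<sigma> by (auto simp: facets_def)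
  define J where "J = {j \<in> states r \<sigma>. restrict j \<tau> = restrict i \<tau>}"
  have finJ: "finite J"
    using finite_states[OF finite_subset[OF \<sigma>_sub]] by (simp add: J_def)
  have col: "(\<Sum>j\<in>J. c k * suff_stat (\<sigma>, j) k) = (if restrict k \<tau> = restrict i \<tau> then c k else 0)"
    if "k \<in> ?S" for k
  proof -
    have "(\<Sum>j\<in>J. c k * suff_stat (\<sigma>, j) k) = (\<Sum>j\<in>J. if restrict k \<sigma> = j then c k else 0)"
      by (intro sum.cong) (auto simp: suff_stat_def)
    also have "\<dots> = (if restrict k \<sigma> \<in> J then c k else 0)"
      using finJ by simp
    also have "restrict k \<sigma> \<in> J \<longleftrightarrow> restrict k \<tau> = restrict i \<tau>"
      using restrict_in_states[of k r "{1..m}" \<sigma>] that \<sigma>_sub \<sigma>(2)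
      by (simp add: J_def basis_states_def Int_absorb1)
    finally show ?thesis .
  qed
  have other: "c k = 0" if k: "k \<in> ?S" "restrict k \<tau> = restrict i \<tau>" "k \<noteq> i" for k
  proof -
    have on_\<tau>: "k f = i f" if "f \<in> \<tau>" for f
      using fun_cong[OF k(2), of f] that by simp
    then have "\<tau> \<subseteq> support m k" by (auto simp: \<tau>_def support_def)
    moreover have "support m k \<noteq> \<tau>"
    proof
      assume eq: "support m k = \<tau>"
      have "k f = i f" if "f \<in> {1..m}" for f
      proof (cases "f \<in> \<tau>")
        case False
        then have "f \<notin> support m i" "f \<notin> support m k" using eq by (simp_all add: \<tau>_def)
        with that show ?thesis by (simp add: support_def)
      qed (rule on_\<tau>)
      moreover have "k \<in> states r {1..m}" using k(1) by (simp add: basis_states_def)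
      ultimately have "k = i" using i(1) unfolding states_def by (intro PiE_ext)
      with k(3) show False ..
    qed
    moreover have "support m k \<subseteq> {1..m}" by (auto simp: support_def)
    ultimately have "{1..m} - support m k \<subset> {1..m} - support m i"
      unfolding \<tau>_def by blast
    then show ?thesis using k(1) by (intro less.hyps psubset_card_mono) auto
  qed
  have "0 = (\<Sum>j\<in>J. \<Sum>k\<in>?S. c k * suff_stat (\<sigma>, j) k)"
  proof (rule sum.neutral[symmetric], rule ballI, rule zero)
    fix j assume "j \<in> J"
    then show "(\<sigma>, j) \<in> parameter_indices r \<Delta>"
      using \<sigma>(1) by (simp add: parameter_indices_def J_def)
  qed
  also have "\<dots> = (\<Sum>k\<in>?S. if restrict k \<tau> = restrict i \<tau> then c k else 0)"
    by (subst sum.swap) (rule sum.cong[OF refl col])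
  also have "\<dots> = (\<Sum>k\<in>?S. if k = i then c i else 0)"
    by (rule sum.cong[OF refl]) (use other in metis)
  also have "\<dots> = c i"
    using less.prems finite_basis_states by simp
  finally show ?case by simp
qed

text \<open>
  Inserting \<open>t\<close> into or removing it from \<open>U\<close> flips the sign of a summand and leaves the
  \<open>\<sigma>\<close>-marginal of the truncated state unchanged, because \<open>t \<notin> \<sigma>\<close>.
\<close>

lemma alternating_sum_truncations_eq_0:
  fixes T :: "nat set"
  assumes "t \<in> T" "t \<notin> \<sigma>"
  shows "(\<Sum>U\<in>Pow T. (- 1) ^ card U * suff_stat (\<sigma>, j) (truncation m U i)) = (0 :: 'a::field_char_0)"
    (is "sum ?g _ = 0")
proof (cases "finite T")
  case True
  define toggle where "toggle U = (if t \<in> U then U - {t} else insert t U)" for U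
  have "sum ?g (Pow T) = (\<Sum>U\<in>Pow T. - ?g U)"
  proof (rule sum.reindex_bij_witness[of _ toggle toggle])
    fix U assume U: "U \<in> Pow T"
    then have "finite U" using True finite_subset by auto
    then have sign: "(- 1 :: 'a) ^ card (toggle U) = - ((- 1) ^ card U)"
    proof (cases "t \<in> U")
      case True
      with \<open>finite U\<close> have "card U = Suc (card (U - {t}))" by (rule card.remove)
      with True show ?thesis by (simp only: toggle_def if_True power_Suc) simp
    qed (use \<open>finite U\<close> in \<open>simp add: toggle_def\<close>)
    have "restrict (truncation m (toggle U) i) \<sigma> = restrict (truncation m U i) \<sigma>"
      using assms by (auto simp: fun_eq_iff truncation_def toggle_def restrict_def)
    then show "- ?g (toggle U) = ?g U"
      by (simp add: sign suff_stat_def)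
  qed (use assms in \<open>auto simp: toggle_def split: if_splits\<close>)
  then have "sum ?g (Pow T) = - sum ?g (Pow T)" by (simp add: sum_negf)
  then show ?thesis by simp
  \<comment> \<open>A sum over the infinite set \<open>Pow T\<close> is \<open>0\<close> by convention.\<close>
qed auto

text \<open>
  Induction on the size of the support \<open>T\<close> of \<open>i\<close>. If \<open>T\<close> is not a face, no facet contains it, so
  the alternating sum over all \<open>U \<subseteq> T\<close> vanishes in every row. Its term for \<open>U = T\<close> is the column
  of \<open>i\<close> up to sign, and the other terms belong to states with support \<open>U \<subset> T\<close>.
\<close>

lemma basis_columns_span:
  assumes \<Delta>: "abstract_simplicial_complex m \<Delta>"
    and r: "\<And>f. f \<in> {1..m} \<Longrightarrow> r f \<ge> 1"
    and "i \<in> states r {1..m}"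
  shows "\<exists>c :: _ \<Rightarrow> 'a::field_char_0. \<forall>\<rho>\<in>parameter_indices r \<Delta>.
    suff_stat \<rho> i = (\<Sum>k\<in>basis_states m r \<Delta>. c k * suff_stat \<rho> k)"
  using \<open>i \<in> states r {1..m}\<close>
proof (induction "card (support m i)" arbitrary: i rule: less_induct)
  case less
  let ?S = "basis_states m r \<Delta>"
  define T where "T = support m i"
  have finT: "finite T" by (simp add: T_def support_def)
  show ?case
  proof (cases "T \<in> \<Delta>")
    case True
    then have "i \<in> ?S" using less.prems by (simp add: basis_states_def T_def)
    show ?thesis
    proof (intro exI ballI)
      fix \<rho>
      have "(\<Sum>k\<in>?S. (if k = i then 1 else 0) * suff_stat \<rho> k :: 'a) = (\<Sum>k\<in>?S. if k = i then suff_stat \<rho> i else 0)"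
        by (intro sum.cong) auto
      then show "suff_stat \<rho> i = (\<Sum>k\<in>?S. (if k = i then 1 else 0) * suff_stat \<rho> k :: 'a)"
        using \<open>i \<in> ?S\<close> finite_basis_states by simp
    qed
  next
    case False
    have "\<exists>c :: _ \<Rightarrow> 'a. \<forall>\<rho>\<in>parameter_indices r \<Delta>.
        suff_stat \<rho> (truncation m U i) = (\<Sum>k\<in>?S. c k * suff_stat \<rho> k)" if "U \<subset> T" for U
    proof (rule less.hyps)
      have "support m (truncation m U i) = U"
        using that by (auto simp: truncation_def support_def T_def)
      then show "card (support m (truncation m U i)) < card (support m i)"
        using psubset_card_mono[OF finT that] by (simp add: T_def)
      show "truncation m U i \<in> states r {1..m}"
        using less.prems r by (auto simp: states_def truncation_def PiE_iff)
    qed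
    then obtain C :: "nat set \<Rightarrow> _ \<Rightarrow> 'a" where C: "\<And>U \<rho>. \<lbrakk>U \<subset> T; \<rho> \<in> parameter_indices r \<Delta>\<rbrakk> \<Longrightarrow>
        suff_stat \<rho> (truncation m U i) = (\<Sum>k\<in>?S. C U k * suff_stat \<rho> k)"
      by metis
    define c where "c k = - ((- 1) ^ card T) * (\<Sum>U\<in>Pow T - {T}. (- 1) ^ card U * C U k)" for k
    have trunc: "truncation m T i = i"
      using less.prems by (auto simp: fun_eq_iff truncation_def T_def support_def states_def PiE_iff extensional_def)
    have "suff_stat \<rho> i = (\<Sum>k\<in>?S. c k * suff_stat \<rho> k)" if \<rho>: "\<rho> \<in> parameter_indices r \<Delta>" for \<rho>
    proof -
      obtain \<sigma> j where \<rho>_eq: "\<rho> = (\<sigma>, j)" "\<sigma> \<in> \<Delta>" using \<rho> by (auto simp: parameter_indices_def facets_def)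
      then have "\<not> T \<subseteq> \<sigma>" using \<Delta> False by (auto simp: abstract_simplicial_complex_def)
      then obtain t where t: "t \<in> T" "t \<notin> \<sigma>" by auto
      define R :: 'a where "R = (\<Sum>U\<in>Pow T - {T}. (- 1) ^ card U * suff_stat \<rho> (truncation m U i))"
      have "(- 1) ^ card T * suff_stat \<rho> i + R = 0"
        using alternating_sum_truncations_eq_0[OF t, of j m i, where 'a = 'a] finT
        by (simp add: sum.remove[of "Pow T" T] trunc R_def \<rho>_eq)
      then have "(- 1) ^ card T * suff_stat \<rho> i = - R" by (rule eq_neg_iff_add_eq_0[THEN iffD2])
      then have "suff_stat \<rho> i = - ((- 1) ^ card T) * R"
        by (cases "even (card T)") (auto simp: minus_equation_iff)
      also have "R = (\<Sum>U\<in>Pow T - {T}. (- 1) ^ card U * (\<Sum>k\<in>?S. C U k * suff_stat \<rho> k))"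
        unfolding R_def
      proof (rule sum.cong[OF refl])
        fix U assume "U \<in> Pow T - {T}"
        then have "U \<subset> T" by auto
        from C[OF this \<rho>] show "(- 1) ^ card U * suff_stat \<rho> (truncation m U i)
            = (- 1) ^ card U * (\<Sum>k\<in>?S. C U k * suff_stat \<rho> k)" by simp
      qed
      also have "\<dots> = (\<Sum>k\<in>?S. (\<Sum>U\<in>Pow T - {T}. (- 1) ^ card U * C U k) * suff_stat \<rho> k)"
        unfolding sum_distrib_left sum_distrib_right by (subst sum.swap) (simp add: mult.assoc)
      also have "- ((- 1) ^ card T) * \<dots> = (\<Sum>k\<in>?S. c k * suff_stat \<rho> k)"
        unfolding c_def sum_distrib_left[of _ _ ?S] by (simp only: mult.assoc)
      finally show ?thesis .
    qed
    then show ?thesis by blast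
  qed
qed

section \<open>The Hilbert function of a Stanley-Reisner ring\<close>

lemma polynomial_ring_simps [simp]:
  "p \<otimes>\<^bsub>polynomial_ring m\<^esub> q = p * q"
  "p \<oplus>\<^bsub>polynomial_ring m\<^esub> q = p + q"
  "\<zero>\<^bsub>polynomial_ring m\<^esub> = 0"
  "\<one>\<^bsub>polynomial_ring m\<^esub> = 1"
  by (simp_all add: polynomial_ring_def)

lemma mem_carrier_polynomial_ring:
  "p \<in> carrier (polynomial_ring m) \<longleftrightarrow> Poly_Mapping.keys p \<subseteq> expos m"
  by (simp add: polynomial_ring_def)

lemma single_in_carrier_polynomial_ring [simp]:
  "a \<in> expos m \<Longrightarrow> Poly_Mapping.single a c \<in> carrier (polynomial_ring m)"
  by (simp add: mem_carrier_polynomial_ring)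

lemma zero_in_expos [simp]: "0 \<in> expos m"
  by (simp add: expos_def)

lemma keys_add_expo: "Poly_Mapping.keys (a + b) = Poly_Mapping.keys a \<union> Poly_Mapping.keys b"
  for a b :: expo
  by (auto simp: in_keys_iff lookup_add)

lemma minus_polynomial_ring:
  fixes p :: "('k::field) mpoly"
  assumes "p \<in> carrier (polynomial_ring m)"
  shows "\<ominus>\<^bsub>polynomial_ring m\<^esub> p = - p"
proof -
  interpret cring "polynomial_ring m :: 'k mpoly ring" by (rule cring_polynomial_ring)
  have "- p \<in> carrier (polynomial_ring m)"
    using assms by (auto simp: mem_carrier_polynomial_ring in_keys_iff subset_iff)
  then show ?thesis
    using assms by (intro minus_equality) auto
qed

lemma prod_var:
  "finite \<tau> \<Longrightarrow>
    (\<Prod>i\<in>\<tau>. var i :: ('k::field) mpoly) = Poly_Mapping.single (\<Sum>i\<in>\<tau>. Poly_Mapping.single i 1) 1"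
  by (induction rule: finite_induct) (simp_all add: var_def mult_single)

lemma keys_sum_single: "finite (\<tau> :: nat set) \<Longrightarrow> Poly_Mapping.keys (\<Sum>i\<in>\<tau>. Poly_Mapping.single i (Suc 0)) = \<tau>"
  by (induction rule: finite_induct) (simp_all add: keys_add_expo)

lemma generator_in_carrier:
  assumes "\<tau> \<subseteq> {1..m}"
  shows "(\<Prod>i\<in>\<tau>. var i :: ('k::field) mpoly) \<in> carrier (polynomial_ring m)"
  using assms finite_subset[OF assms]
  by (simp add: prod_var mem_carrier_polynomial_ring expos_def keys_sum_single)

lemma ideal_stanley_reisner:
  "ideal (stanley_reisner_ideal m \<Delta>) (polynomial_ring m :: ('k::field) mpoly ring)"
proof -
  interpret cring "polynomial_ring m :: 'k mpoly ring" by (rule cring_polynomial_ring)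
  show ?thesis
    unfolding stanley_reisner_ideal_def
    by (rule genideal_ideal) (auto intro!: generator_in_carrier simp del: One_nat_def)
qed

text \<open>
  A monomial whose support \<open>\<tau>\<close> is a nonface is a multiple of the generator \<open>\<Prod>i\<in>\<tau>. x\<^sub>i\<close>.
\<close>

lemma single_nonface_in_stanley_reisner:
  assumes a: "a \<in> expos m" "Poly_Mapping.keys a \<notin> \<Delta>"
  shows "Poly_Mapping.single a c \<in> (stanley_reisner_ideal m \<Delta> :: ('k::field) mpoly set)"
proof -
  interpret cring "polynomial_ring m :: 'k mpoly ring" by (rule cring_polynomial_ring)
  interpret ideal "stanley_reisner_ideal m \<Delta> :: 'k mpoly set" "polynomial_ring m"
    by (rule ideal_stanley_reisner)
  define \<tau> where "\<tau> = Poly_Mapping.keys a"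
  define s :: expo where "s = (\<Sum>i\<in>\<tau>. Poly_Mapping.single i 1)"
  have fin: "finite \<tau>" by (simp add: \<tau>_def)
  have \<tau>: "\<tau> \<subseteq> {1..m}" using a by (simp add: expos_def \<tau>_def)
  have gen: "(\<Prod>i\<in>\<tau>. var i :: 'k mpoly) \<in> stanley_reisner_ideal m \<Delta>"
    unfolding stanley_reisner_ideal_def
    by (rule subsetD[OF genideal_self])
      (use a \<tau> in \<open>auto simp del: One_nat_def simp: \<tau>_def intro!: generator_in_carrier exI[of _ \<tau>]\<close>)
  have look: "Poly_Mapping.lookup s i = (if i \<in> \<tau> then 1 else 0)" for i
    using fin unfolding s_def
    by (induction rule: finite_induct) (auto simp: lookup_add lookup_single when_def)
  have eq: "a - s + s = a"
    by (rule poly_mapping_eqI) (auto simp: lookup_add lookup_minus look \<tau>_def in_keys_iff)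
  have "a - s \<in> expos m"
    using a by (auto simp: expos_def in_keys_iff subset_iff lookup_minus)
  then have "Poly_Mapping.single (a - s) c \<otimes>\<^bsub>polynomial_ring m\<^esub> (\<Prod>i\<in>\<tau>. var i)
      \<in> (stanley_reisner_ideal m \<Delta> :: 'k mpoly set)"
    by (intro I_l_closed gen) simp
  moreover have "(\<Prod>i\<in>\<tau>. var i :: 'k mpoly) = Poly_Mapping.single s 1"
    unfolding s_def by (rule prod_var[OF fin])
  ultimately show ?thesis
    by (simp add: mult_single eq)
qed

text \<open>
  The polynomials all of whose monomials have nonface support form an ideal, because supersets of
  nonfaces are nonfaces. It contains the generators and hence the Stanley-Reisner ideal.
\<close>

lemma keys_stanley_reisner:
  fixes p :: "('k::field) mpoly"
  assumes \<Delta>: "abstract_simplicial_complex m \<Delta>"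
    and p: "p \<in> stanley_reisner_ideal m \<Delta>" and a: "a \<in> Poly_Mapping.keys p"
  shows "Poly_Mapping.keys a \<notin> \<Delta>"
proof -
  interpret cring "polynomial_ring m :: 'k mpoly ring" by (rule cring_polynomial_ring)
  define J :: "'k mpoly set" where
    "J = {p \<in> carrier (polynomial_ring m). \<forall>a\<in>Poly_Mapping.keys p. Poly_Mapping.keys a \<notin> \<Delta>}"
  have up: "Poly_Mapping.keys (a + b) \<notin> \<Delta>" if "Poly_Mapping.keys a \<notin> \<Delta>" for a b :: expo
    using \<Delta> that unfolding keys_add_expo abstract_simplicial_complex_def by blast
  have mult: "q * p \<in> J" if "p \<in> J" "q \<in> carrier (polynomial_ring m)" for p q
  proof -
    have "q \<otimes>\<^bsub>polynomial_ring m\<^esub> p \<in> carrier (polynomial_ring m)"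
      using that by (intro m_closed) (auto simp: J_def)
    moreover have "Poly_Mapping.keys a \<notin> \<Delta>" if "a \<in> Poly_Mapping.keys (q * p)" for a
    proof -
      obtain b b' where "a = b + b'" "b' \<in> Poly_Mapping.keys p"
        using \<open>a \<in> Poly_Mapping.keys (q * p)\<close> keys_mult[of q p] by auto
      then show ?thesis using \<open>p \<in> J\<close> up[of b' b] by (auto simp: J_def add.commute)
    qed
    ultimately show ?thesis by (simp add: J_def)
  qed
  have "ideal J (polynomial_ring m)"
  proof (rule idealI)
    show "subgroup J (add_monoid (polynomial_ring m))"
    proof (rule add.subgroupI)
      show "J \<noteq> {}" by (auto simp: J_def mem_carrier_polynomial_ring intro!: exI[of _ 0])
      show "\<ominus>\<^bsub>polynomial_ring m\<^esub> p \<in> J" if "p \<in> J" for p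
        using that
        by (auto simp: J_def minus_polynomial_ring mem_carrier_polynomial_ring in_keys_iff subset_iff)
      show "p \<oplus>\<^bsub>polynomial_ring m\<^esub> q \<in> J" if "p \<in> J" "q \<in> J" for p q
        using that Poly_Mapping.keys_add[of p q] by (auto simp: J_def mem_carrier_polynomial_ring)
    qed (auto simp: J_def)
  qed (use mult in \<open>auto simp: mult.commute intro: ring_axioms\<close>)
  moreover have "{\<Prod>i\<in>\<tau>. var i |\<tau>. \<tau> \<subseteq> {1..m} \<and> \<tau> \<notin> \<Delta>} \<subseteq> J"
  proof safe
    fix \<tau> assume \<tau>: "\<tau> \<subseteq> {1..m}" "\<tau> \<notin> \<Delta>"
    then show "(\<Prod>i\<in>\<tau>. var i) \<in> J"
      using generator_in_carrier[OF \<tau>(1)] finite_subset[OF \<tau>(1)]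
      by (simp add: J_def prod_var keys_sum_single)
  qed
  ultimately have "stanley_reisner_ideal m \<Delta> \<subseteq> J"
    unfolding stanley_reisner_ideal_def by (rule genideal_minimal)
  then show ?thesis using p a by (auto simp: J_def)
qed

text \<open>
  The image of this subfield in \<open>S/I\<close> is the scalar field of the dimension in the Hilbert function.
\<close>

lemma subfield_constants: "subfield (range (Poly_Mapping.single 0)) (polynomial_ring m :: ('k::field) mpoly ring)"
proof -
  interpret cring "polynomial_ring m :: 'k mpoly ring" by (rule cring_polynomial_ring)
  let ?K = "range (Poly_Mapping.single 0) :: 'k mpoly set"
  have sub: "subring ?K (polynomial_ring m)"
  proof (rule subringI)
    show "\<one>\<^bsub>polynomial_ring m\<^esub> \<in> ?K" by (auto simp flip: single_one)
  qed (auto simp: minus_polynomial_ring mult_single simp flip: single_uminus single_add)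
  have "Units (polynomial_ring m \<lparr>carrier := ?K\<rparr>) = ?K - {0}"
  proof (intro Set.set_eqI iffI)
    fix p assume "p \<in> Units (polynomial_ring m \<lparr>carrier := ?K\<rparr>)"
    then show "p \<in> ?K - {0}" by (auto simp: Units_def)
  next
    fix p assume "p \<in> ?K - {0}"
    then obtain c :: 'k where "p = Poly_Mapping.single 0 c" "c \<noteq> 0"
      by (metis DiffE imageE insertI1 single_zero)
    then show "p \<in> Units (polynomial_ring m \<lparr>carrier := ?K\<rparr>)"
      by (auto simp: Units_def mult_single intro!: exI[of _ "inverse c"] simp flip: single_one)
  qed
  then show ?thesis
    using subfieldI[OF subcringI'[OF sub]] by simp
qed

text \<open>
  The graded piece of degree \<open>a\<close> consists of the multiples of the class of \<open>x\<^sup>a\<close>, so its dimension is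
  \<open>1\<close> or \<open>0\<close> according to whether \<open>x\<^sup>a\<close> lies outside the ideal. For \<open>a = 0\<close> the empty face
  ensures that the quotient is not the zero ring, so that the constants embed as a subfield.
\<close>

lemma hilbert_function_stanley_reisner:
  assumes \<Delta>: "abstract_simplicial_complex m \<Delta>" and a: "a \<in> expos m"
  shows "hilbert_function m (stanley_reisner_ideal m \<Delta> :: ('k::field) mpoly set) a
    = (if Poly_Mapping.keys a \<in> \<Delta> then 1 else 0)"
proof -
  let ?R = "polynomial_ring m :: 'k mpoly ring"
  let ?I = "stanley_reisner_ideal m \<Delta> :: 'k mpoly set"
  interpret ideal ?I ?R by (rule ideal_stanley_reisner)
  interpret h: ring_hom_ring ?R "?R Quot ?I" "quotient_map m ?I" by (rule rcos_ring_hom_ring)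
  have zero: "\<zero>\<^bsub>?R Quot ?I\<^esub> = ?I" by (simp add: FactRing_def)
  have ker: "quotient_map m ?I p = ?I \<longleftrightarrow> p \<in> ?I" if "p \<in> carrier ?R" for p
    using a_rcos_self[OF that] a_rcos_const[of p] by auto
  have mono: "Poly_Mapping.single b c \<in> ?I \<longleftrightarrow> c = 0"
    if "Poly_Mapping.keys b \<in> \<Delta>" for b and c :: 'k
  proof
    show "c = 0" if "Poly_Mapping.single b c \<in> ?I"
      using keys_stanley_reisner[OF \<Delta> that, of b] \<open>Poly_Mapping.keys b \<in> \<Delta>\<close>
      by (cases "c = 0") auto
    show "Poly_Mapping.single b c \<in> ?I" if "c = 0"
      using that additive_subgroup.zero_closed[OF additive_subgroup_axioms] by simp
  qed
  have "\<one>\<^bsub>?R Quot ?I\<^esub> \<noteq> \<zero>\<^bsub>?R Quot ?I\<^esub>"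
  proof
    assume "\<one>\<^bsub>?R Quot ?I\<^esub> = \<zero>\<^bsub>?R Quot ?I\<^esub>"
    then have "quotient_map m ?I 1 = ?I" by (simp add: FactRing_def)
    then have "(1 :: 'k mpoly) \<in> ?I" using ker[of 1] one_closed by simp
    then show False
      using mono[of 0 1] \<Delta> by (simp add: abstract_simplicial_complex_def)
  qed
  then have K: "subfield (graded_piece m ?I 0) (?R Quot ?I)"
    unfolding graded_piece_def using h.img_is_subfield(2)[OF subfield_constants] by blast
  have "h.S.dimension (if Poly_Mapping.keys a \<in> \<Delta> then 1 else 0) (graded_piece m ?I 0) (graded_piece m ?I a)"
  proof (cases "Poly_Mapping.keys a \<in> \<Delta>")
    case False
    have "quotient_map m ?I (Poly_Mapping.single a c) = ?I" for c
      using ker a single_nonface_in_stanley_reisner[OF a False] by simp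
    then have "graded_piece m ?I a = {\<zero>\<^bsub>?R Quot ?I\<^esub>}"
      by (auto simp: graded_piece_def zero)
    then show ?thesis using False by auto
  next
    case True
    let ?v = "quotient_map m ?I (Poly_Mapping.single a 1)"
    have v: "?v \<in> carrier (?R Quot ?I)" using a by (intro h.hom_closed) simp
    have "?v \<notin> {\<zero>\<^bsub>?R Quot ?I\<^esub>}" using ker mono[OF True, of 1] a by (simp add: zero)
    from h.S.dimension.Suc_dim[OF v this h.S.dimension.zero_dim, of "graded_piece m ?I 0"]
    have "h.S.dimension 1 (graded_piece m ?I 0)
        (h.S.line_extension (graded_piece m ?I 0) ?v {\<zero>\<^bsub>?R Quot ?I\<^esub>})" by simp
    also have "h.S.line_extension (graded_piece m ?I 0) ?v {\<zero>\<^bsub>?R Quot ?I\<^esub>} = graded_piece m ?I a"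
    proof -
      have "quotient_map m ?I (Poly_Mapping.single 0 c) \<otimes>\<^bsub>?R Quot ?I\<^esub> ?v \<oplus>\<^bsub>?R Quot ?I\<^esub> \<zero>\<^bsub>?R Quot ?I\<^esub>
          = quotient_map m ?I (Poly_Mapping.single a c)" for c
      proof -
        have "quotient_map m ?I (Poly_Mapping.single 0 c) \<otimes>\<^bsub>?R Quot ?I\<^esub> ?v
            = quotient_map m ?I (Poly_Mapping.single 0 c \<otimes>\<^bsub>?R\<^esub> Poly_Mapping.single a 1)"
          using a by (subst h.hom_mult) auto
        then show ?thesis using a by (simp add: mult_single)
      qed
      then show ?thesis
        by (auto simp: set_eq_iff h.S.line_extension_mem_iff graded_piece_def image_iff)
    qed
    finally show ?thesis using True by simp
  qed
  from h.S.dimI[OF K this] show ?thesis by (simp add: hilbert_function_def over_def)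
qed

section \<open>Summation of the exponential Hilbert series\<close>

lemma has_sum_exp_minus_one:
  fixes x :: real
  shows "((\<lambda>n. x ^ n / fact n) has_sum (exp x - 1)) {1..}"
    and "(\<lambda>n. norm (x ^ n / fact n)) summable_on {1..}"
proof -
  have sm: "summable (\<lambda>n. norm (x ^ n / fact n))"
    using summable_norm_exp[of x] by (simp add: field_simps)
  have "(\<lambda>n. x ^ n / fact n) sums exp x"
    using exp_converges[of x] by (simp add: field_simps)
  from norm_summable_imp_has_sum[OF sm this]
  have all: "((\<lambda>n. x ^ n / fact n) has_sum exp x) UNIV" .
  have "((\<lambda>n. x ^ n / fact n) has_sum (exp x - (\<Sum>n\<in>{0}. x ^ n / fact n))) (UNIV - {0})"
    by (rule has_sum_Diff[OF all has_sum_finite]) auto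
  moreover have "UNIV - {0} = {1::nat..}" by auto
  ultimately show "((\<lambda>n. x ^ n / fact n) has_sum (exp x - 1)) {1..}" by simp
  show "(\<lambda>n. norm (x ^ n / fact n)) summable_on {1..}"
    using norm_summable_imp_summable_on[of "\<lambda>n. norm (x ^ n / fact n)"] sm
      summable_on_subset_banach by fastforce
qed

text \<open>
  An exponent with support \<open>F\<close> is a family of positive exponents indexed by \<open>F\<close>, and the sum over
  such families of a product of terms is the product of the exponential series without their
  constant terms. Absolute convergence of the factors gives summability of the products.
\<close>

lemma has_sum_exponents_with_support:
  fixes x :: "nat \<Rightarrow> real"
  assumes F: "F \<subseteq> {1..m}"
  shows "((\<lambda>a. (\<Prod>i=1..m. x i ^ Poly_Mapping.lookup a i) / (\<Prod>i=1..m. fact (Poly_Mapping.lookup a i)))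
    has_sum (\<Prod>i\<in>F. exp (x i) - 1)) {a :: expo. Poly_Mapping.keys a = F}"
proof -
  have fin: "finite F" using F finite_subset by blast
  define t where "t i n = x i ^ n / fact n" for i and n :: nat
  let ?w = "\<lambda>g. \<Prod>i\<in>F. t i (g i)"
  have t: "(t i has_sum (exp (x i) - 1)) {1..}" "(\<lambda>n. norm (t i n)) summable_on {1..}" for i
    unfolding t_def by (rule has_sum_exp_minus_one)+
  have "infsum ?w (PiE F (\<lambda>_. {1..})) = (\<Prod>i\<in>F. infsum (t i) {1..})"
    by (rule infsum_prod_PiE_abs) (use fin t in auto)
  also have "\<dots> = (\<Prod>i\<in>F. exp (x i) - 1)"
    using t by (intro prod.cong infsumI) auto
  finally have val: "infsum ?w (PiE F (\<lambda>_. {1..})) = (\<Prod>i\<in>F. exp (x i) - 1)" .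
  have "Infinite_Set_Sum.abs_summable_on ?w (PiE F (\<lambda>_. {1..}))"
    by (rule abs_summable_on_prod_PiE) (use fin t(2) in \<open>simp_all flip: abs_summable_equivalent\<close>)
  then have "?w summable_on PiE F (\<lambda>_. {1..})"
    using abs_summable_equivalent abs_summable_summable by blast
  then have sum: "(?w has_sum (\<Prod>i\<in>F. exp (x i) - 1)) (PiE F (\<lambda>_. {1..}))"
    using val has_sum_infsum by fastforce
  define P where "P g = Abs_poly_mapping (\<lambda>i. if i \<in> F then g i else (0::nat))" for g
  have P: "Poly_Mapping.lookup (P g) = (\<lambda>i. if i \<in> F then g i else 0)" for g
    unfolding P_def by (rule lookup_Abs_poly_mapping) (use fin in \<open>auto intro: finite_subset[of _ F]\<close>)
  show ?thesis
  proof (subst has_sum_reindex_bij_witness[where T = "PiE F (\<lambda>_. {1..})" and i = P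
        and j = "\<lambda>a. restrict (Poly_Mapping.lookup a) F" and h = ?w])
    fix a :: expo assume a: "a \<in> {a :: expo. Poly_Mapping.keys a = F}"
    then show "P (restrict (Poly_Mapping.lookup a) F) = a"
      by (intro poly_mapping_eqI) (auto simp: P in_keys_iff)
    show "restrict (Poly_Mapping.lookup a) F \<in> PiE F (\<lambda>_. {1..})"
      using a by (auto simp: in_keys_iff Suc_le_eq)
    have 0: "Poly_Mapping.lookup a i = 0" if "i \<notin> F" for i
      using a that by (auto simp: in_keys_iff)
    have "(\<Prod>i=1..m. x i ^ Poly_Mapping.lookup a i) / (\<Prod>i=1..m. fact (Poly_Mapping.lookup a i)) = (\<Prod>i=1..m. t i (Poly_Mapping.lookup a i))"
      by (simp add: prod_dividef t_def)
    also have "\<dots> = (\<Prod>i\<in>F. t i (Poly_Mapping.lookup a i))"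
      by (rule prod.mono_neutral_right) (use F 0 in \<open>auto simp: t_def\<close>)
    finally show "?w (restrict (Poly_Mapping.lookup a) F)
        = (\<Prod>i=1..m. x i ^ Poly_Mapping.lookup a i) / (\<Prod>i=1..m. fact (Poly_Mapping.lookup a i))" by simp
  next
    fix g assume g: "g \<in> PiE F (\<lambda>_. {1::nat..})"
    show "restrict (Poly_Mapping.lookup (P g)) F = g"
      using g by (auto simp: P fun_eq_iff PiE_def extensional_def)
    show "P g \<in> {a :: expo. Poly_Mapping.keys a = F}"
      using g by (auto simp: in_keys_iff P PiE_iff Suc_le_eq split: if_splits)
  qed (use sum in auto)
qed

lemma has_sum_Union_finite_disjoint:
  assumes "finite I" "\<And>i. i \<in> I \<Longrightarrow> (f has_sum s i) (A i)" "disjoint_family_on A I"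
  shows "((f :: _ \<Rightarrow> real) has_sum (\<Sum>i\<in>I. s i)) (\<Union>i\<in>I. A i)"
  using assms
proof (induction I rule: finite_induct)
  case (insert i I)
  have "A i \<inter> (\<Union>j\<in>I. A j) = {}"
    using insert.prems(2) insert.hyps by (fastforce simp: disjoint_family_on_def)
  moreover have "disjoint_family_on A I"
    using insert.prems(2) by (auto simp: disjoint_family_on_def)
  ultimately show ?case
    using insert by (auto intro!: has_sum_Un_disjoint)
qed auto

text \<open>
  Only exponents whose support is a face contribute, each with its full weight, and grouping them
  by support leaves one product of exponential series for every face.
\<close>

lemma exp_hilbert_series_eq_sum_over_faces:
  assumes \<Delta>: "abstract_simplicial_complex m \<Delta>"
    and hf: "\<And>a. a \<in> expos m \<Longrightarrow> hilbert_function m I a = (if Poly_Mapping.keys a \<in> \<Delta> then 1 else 0)"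
  shows "exp_hilbert_series m I x = (\<Sum>F\<in>\<Delta>. \<Prod>i\<in>F. exp (x i) - 1)"
proof -
  let ?w = "\<lambda>a. (\<Prod>i=1..m. x i ^ Poly_Mapping.lookup a i) / (\<Prod>i=1..m. fact (Poly_Mapping.lookup a i))"
  have sub: "F \<subseteq> {1..m}" if "F \<in> \<Delta>" for F
    using \<Delta> that by (auto simp: abstract_simplicial_complex_def)
  have "finite \<Delta>" by (rule finite_subset[of _ "Pow {1..m}"]) (use sub in auto)
  have "exp_hilbert_series m I x = infsum ?w (\<Union>F\<in>\<Delta>. {a. Poly_Mapping.keys a = F})"
    unfolding exp_hilbert_series_def
    by (rule infsum_cong_neutral) (use sub in \<open>auto simp: hf expos_def\<close>)
  also have "\<dots> = (\<Sum>F\<in>\<Delta>. \<Prod>i\<in>F. exp (x i) - 1)"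
    by (intro infsumI has_sum_Union_finite_disjoint has_sum_exponents_with_support
        \<open>finite \<Delta>\<close> sub) (auto simp: disjoint_family_on_def)
  finally show ?thesis .
qed

section \<open>Rank of the matrix of sufficient statistics\<close>

theorem proposition10:
  fixes m :: nat and r :: "nat \<Rightarrow> nat" and \<Delta> :: "nat set set"
    and rs :: "(nat set \<times> (nat \<Rightarrow> nat)) list" and cs :: "(nat \<Rightarrow> nat) list"
  assumes "abstract_simplicial_complex m \<Delta>"
    and "\<And>i. i \<in> {1..m} \<Longrightarrow> r i \<ge> 1"
    and "distinct rs" and "set rs = parameter_indices r \<Delta>"
    and "distinct cs" and "set cs = states r {1..m}"
  shows "real (vec_space.rank (length rs) (suff_stat_matrix rs cs)) =
    exp_hilbert_series m (stanley_reisner_ideal m \<Delta> :: ('k::field) mpoly set) (\<lambda>i. ln (real (r i)))"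
proof -
  have "vec_space.rank (length rs) (suff_stat_matrix rs cs) = card (basis_states m r \<Delta>)"
    unfolding suff_stat_matrix_def
  proof (rule rank_eq_card_of_column_basis)
    show "basis_states m r \<Delta> \<subseteq> set cs"
      by (auto simp: basis_states_def assms(6))
    show "c i = 0"
      if "\<And>\<rho>. \<rho> \<in> set rs \<Longrightarrow> (\<Sum>j\<in>basis_states m r \<Delta>. c j * suff_stat \<rho> j) = 0"
        and "i \<in> basis_states m r \<Delta>" for c :: "_ \<Rightarrow> rat" and i
      by (rule basis_columns_independent[OF assms(1) that[unfolded assms(4)]])
    show "\<exists>c :: _ \<Rightarrow> rat. \<forall>\<rho>\<in>set rs. suff_stat \<rho> i = (\<Sum>j\<in>basis_states m r \<Delta>. c j * suff_stat \<rho> j)"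
      if "i \<in> set cs" for i
      using basis_columns_span[OF assms(1,2)] that by (simp add: assms(4,6))
  qed
  also have "real (card (basis_states m r \<Delta>)) = (\<Sum>F\<in>\<Delta>. \<Prod>f\<in>F. exp (ln (real (r f))) - 1)"
  proof -
    have "real (r f - 1) = exp (ln (real (r f))) - 1" if "F \<in> \<Delta>" "f \<in> F" for F f
    proof -
      have "r f \<ge> 1" using assms(2) face_subset[OF assms(1) that(1)] that(2) by blast
      then show ?thesis by (simp add: of_nat_diff)
    qed
    then have "(\<Sum>F\<in>\<Delta>. \<Prod>f\<in>F. real (r f - 1)) = (\<Sum>F\<in>\<Delta>. \<Prod>f\<in>F. exp (ln (real (r f))) - 1)"
      by (intro sum.cong prod.cong refl)
    moreover have "card (basis_states m r \<Delta>) = (\<Sum>F\<in>\<Delta>. \<Prod>f\<in>F. r f - 1)"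
      by (rule card_basis_states) (rule assms(1), rule assms(2))
    ultimately show ?thesis by simp
  qed
  also have "\<dots> = exp_hilbert_series m (stanley_reisner_ideal m \<Delta> :: 'k mpoly set) (\<lambda>i. ln (real (r i)))"
    by (rule exp_hilbert_series_eq_sum_over_faces[OF assms(1)
          hilbert_function_stanley_reisner[OF assms(1)], symmetric])
  finally show ?thesis .
qed

end
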